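(* If $T$ is a triangle with a pair of sides with lengths $a$ and $b$ such that $b/a$ is a rational number $p/q$, where $p,q\in\mathbb N$ and $p\neq q$, then there is a non-trivial $r$-reptiling of $T$ for every square number $r \ge (p+q)^2$.
   Context: An $r$-reptiling of a triangle $T$ ($r \ge 2$) is a subdivision of $T$ into $r$ triangles (tiles) with pairwise disjoint interiors, each similar to $T$ and all mutually congruent. The trivial $n^2$-reptiling of $T$ is obtained by dividing every side of $T$ into $n$ segments of equal length and drawing all lines parallel to the sides of $T$ through the endpoints of these segments. An $n^2$-reptiling is non-trivial if it is not the trivial $n^2$-reptiling. *)

theory Defs
  imports "HOL-Analysis.Analysis"
begin

text \<open>A triangle is a closed, solid, non-degenerate region of the plane.\<close>

definition is_triangle :: "(real^2) set \<Rightarrow> bool" where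
  "is_triangle T \<longleftrightarrow> (\<exists>A B C. \<not> collinear {A, B, C} \<and> T = convex hull {A, B, C})"

text \<open>Similarity and congruence are witnessed by maps of the whole plane; since only distances
  are constrained, orientation-reversing maps (reflections) are allowed.\<close>

definition similar_sets :: "(real^2) set \<Rightarrow> (real^2) set \<Rightarrow> bool" where
  "similar_sets S T \<longleftrightarrow>
     (\<exists>(f :: real^2 \<Rightarrow> real^2) k. k > 0 \<and> (\<forall>x y. dist (f x) (f y) = k * dist x y) \<and> f ` S = T)"

definition congruent_sets :: "(real^2) set \<Rightarrow> (real^2) set \<Rightarrow> bool" where
  "congruent_sets S T \<longleftrightarrow>
     (\<exists>f :: real^2 \<Rightarrow> real^2. (\<forall>x y. dist (f x) (f y) = dist x y) \<and> f ` S = T)"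

text \<open>Tiles need not meet edge to edge.\<close>

definition reptiling :: "nat \<Rightarrow> (real^2) set \<Rightarrow> (real^2) set set \<Rightarrow> bool" where
  "reptiling r T R \<longleftrightarrow>
     r \<ge> 2 \<and> is_triangle T \<and>
     finite R \<and> card R = r \<and> \<Union>R = T \<and>
     (\<forall>S\<in>R. is_triangle S \<and> similar_sets S T) \<and>
     (\<forall>S\<in>R. \<forall>S'\<in>R. congruent_sets S S') \<and>
     pairwise (\<lambda>S S'. interior S \<inter> interior S' = {}) R"

text \<open>The vertices of a triangle are recovered from the point set as its extreme points.\<close>

definition vertices :: "(real^2) set \<Rightarrow> (real^2) set" where
  "vertices T = {v. v extreme_point_of T}"

definition division_points :: "nat \<Rightarrow> (real^2) set \<Rightarrow> (real^2) set" where
  "division_points n T =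
     {u + (real k / real n) *\<^sub>R (v - u) | u v k. u \<in> vertices T \<and> v \<in> vertices T \<and> k \<le> n}"

definition grid_lines :: "nat \<Rightarrow> (real^2) set \<Rightarrow> (real^2) set set" where
  "grid_lines n T =
     {range (\<lambda>t::real. x + t *\<^sub>R (v - u)) | x u v.
        x \<in> division_points n T \<and> u \<in> vertices T \<and> v \<in> vertices T \<and> u \<noteq> v}"

text \<open>The tiles of the trivial reptiling are the closed regions into which the lines cut the
  triangle. The lines include those carrying the sides of the triangle, so the components below
  are open.\<close>

definition trivial_reptiling :: "nat \<Rightarrow> (real^2) set \<Rightarrow> (real^2) set set" where
  "trivial_reptiling n T = closure ` components (T - \<Union>(grid_lines n T))"

definition nontrivial_reptiling :: "nat \<Rightarrow> (real^2) set \<Rightarrow> (real^2) set set \<Rightarrow> bool" where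
  "nontrivial_reptiling r T R \<longleftrightarrow>
     reptiling r T R \<and> (\<exists>n. r = n\<^sup>2 \<and> R \<noteq> trivial_reptiling n T)"

end

theory Submission
  imports Defs
begin

text \<open>Cut \<open>T\<close> by the trivial \<open>n\<^sup>2\<close>-reptiling, \<open>n \<ge> p + q\<close>. The \<open>q \<times> p\<close> block of grid
  parallelograms at the common vertex \<open>C\<close> of the two sides has side lengths \<open>q b / n = p a / n\<close>, so
  it is a rhombus, and it lies in \<open>T\<close> because \<open>p + q \<le> n\<close>. Reflecting the tiles inside the rhombus
  in its diagonal through \<open>C\<close> gives another tiling of the rhombus. As \<open>a \<noteq> b\<close>, the reflected corner
  tile crosses the first grid line parallel to one of the sides, so the new reptiling is not the
  trivial one.\<close>

section \<open>Scaled copies of a triangle\<close>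

text \<open>Unlike in \<open>similar_sets\<close>, the map is a translation after a linear map, so
  that convex hulls, collinearity and inverses can be handled by linear algebra. Orientation is left
  free, which admits reflected tiles.\<close>

definition scaled_copy :: "real \<Rightarrow> (real^2) set \<Rightarrow> (real^2) set \<Rightarrow> bool" where
  "scaled_copy k T S \<longleftrightarrow>
     (\<exists>c L. linear L \<and> (\<forall>v. norm (L v) = k * norm v) \<and> S = (\<lambda>v. c + L v) ` T)"

lemma inj_scaling:
  fixes L :: "real^2 \<Rightarrow> real^2"
  assumes "linear L" "\<And>v. norm (L v) = k * norm v" "k > 0"
  shows "inj L"
proof -
  have "v = 0" if "L v = 0" for v
    using assms(2)[of v] assms(3) that by auto
  then show ?thesis
    using linear_injective_0[OF assms(1)] by blast
qed

lemma scaled_copy_triangle: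
  assumes "scaled_copy k T S" "k > 0" "is_triangle T"
  shows "is_triangle S"
proof -
  obtain c L where L: "linear L" "\<And>v. norm (L v) = k * norm v" and S: "S = (\<lambda>v. c + L v) ` T"
    using assms(1) unfolding scaled_copy_def by blast
  obtain X Y Z where XYZ: "\<not> collinear {X, Y, Z}" and T: "T = convex hull {X, Y, Z}"
    using assms(3) unfolding is_triangle_def by blast
  have "S = (+) c ` (L ` T)"
    unfolding S by (simp add: image_image)
  also have "\<dots> = convex hull ((+) c ` (L ` {X, Y, Z}))"
    unfolding T by (simp add: convex_hull_linear_image[OF L(1)] flip: convex_hull_translation)
  finally have S': "S = convex hull {c + L X, c + L Y, c + L Z}"
    by simp
  have "\<not> collinear ((+) c ` (L ` {X, Y, Z}))"
    using XYZ unfolding collinear_aff_dim aff_dim_translation_eq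
      aff_dim_injective_linear_image[OF L(1) inj_scaling[OF L assms(2)]] .
  then have "\<not> collinear {c + L X, c + L Y, c + L Z}"
    by simp
  then show ?thesis
    unfolding is_triangle_def using S' by blast
qed

lemma scaling_inverse:
  fixes L :: "real^2 \<Rightarrow> real^2"
  assumes "linear L" "\<And>v. norm (L v) = k * norm v" "k > 0"
  obtains G where "linear G" "\<And>v. norm (G v) = norm v / k" "\<And>v. G (L v) = v"
proof -
  obtain G where G: "linear G" "\<And>v. G (L v) = v" "\<And>v. L (G v) = v"
    using linear_injective_isomorphism[OF assms(1) inj_scaling[OF assms]] by blast
  have "norm (G v) = norm v / k" for v
    using assms(2)[of "G v"] assms(3) G(3)[of v] by (simp add: field_simps)
  then show thesis
    using G that by blast
qed

lemma scaled_copy_similar: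
  assumes "scaled_copy k T S" "k > 0"
  shows "similar_sets S T"
proof -
  obtain c L where L: "linear L" "\<And>v. norm (L v) = k * norm v" and S: "S = (\<lambda>v. c + L v) ` T"
    using assms(1) unfolding scaled_copy_def by blast
  obtain G where G: "linear G" "\<And>v. norm (G v) = norm v / k" "\<And>v. G (L v) = v"
    using scaling_inverse[OF L assms(2)] by blast
  \<comment> \<open>\<open>similar_sets S T\<close> wants a map from the tile onto the large
    triangle, hence the inverse and the factor \<open>1 / k\<close>.\<close>
  have "dist (G (x - c)) (G (y - c)) = (1 / k) * dist x y" for x y
    using G(2)[of "x - y"] linear_diff[OF G(1), of "x - c" "y - c"] by (simp add: dist_norm)
  moreover have "(\<lambda>x. G (x - c)) ` S = T"
    unfolding S by (simp add: image_image G(3))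
  ultimately show ?thesis
    unfolding similar_sets_def using assms(2) by (metis zero_less_divide_1_iff)
qed

text \<open>Undoing the first map and then applying the second cancels the factors
  \<open>1 / k\<close> and \<open>k\<close>.\<close>

lemma scaled_copies_congruent:
  assumes "scaled_copy k T S" "scaled_copy k T S'" "k > 0"
  shows "congruent_sets S S'"
proof -
  obtain c L where L: "linear L" "\<And>v. norm (L v) = k * norm v" and S: "S = (\<lambda>v. c + L v) ` T"
    using assms(1) unfolding scaled_copy_def by blast
  obtain c' L' where L': "linear L'" "\<And>v. norm (L' v) = k * norm v"
    and S': "S' = (\<lambda>v. c' + L' v) ` T"
    using assms(2) unfolding scaled_copy_def by blast
  obtain G where G: "linear G" "\<And>v. norm (G v) = norm v / k" "\<And>v. G (L v) = v"
    using scaling_inverse[OF L assms(3)] by blast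
  have "dist (c' + L' (G (x - c))) (c' + L' (G (y - c))) = dist x y" for x y
  proof -
    have "dist (c' + L' (G (x - c))) (c' + L' (G (y - c))) = norm (L' (G (x - y)))"
      by (simp add: dist_norm flip: linear_diff[OF G(1)] linear_diff[OF L'(1)])
    then show ?thesis
      using assms(3) by (simp add: L'(2) G(2) dist_norm)
  qed
  moreover have "(\<lambda>x. c' + L' (G (x - c))) ` S = S'"
    unfolding S S' by (simp add: image_image G(3))
  ultimately show ?thesis
    unfolding congruent_sets_def by (intro exI[of _ "\<lambda>x. c' + L' (G (x - c))"]) simp
qed

lemma triangle_interior_nonempty:
  assumes "is_triangle T"
  shows "interior T \<noteq> {}"
proof -
  obtain X Y Z where XYZ: "\<not> collinear {X, Y, Z}" and T: "T = convex hull {X, Y, Z}"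
    using assms unfolding is_triangle_def by blast
  have "X \<noteq> Y" "X \<noteq> Z" "Y \<noteq> Z" "\<not> affine_dependent {X, Y, Z}"
    using XYZ unfolding collinear_3_eq_affine_dependent by auto
  then show ?thesis
    unfolding T by (subst interior_convex_hull_eq_empty) auto
qed

section \<open>The grid in affine coordinates\<close>

text \<open>Coordinates are chosen so that one step along either side has length one. The flag \<open>True\<close>
  marks the tiles with the same orientation as the large triangle.\<close>

definition std_triangle :: "nat \<Rightarrow> (real^2) set" where
  "std_triangle n = {v. v $ 1 \<ge> 0 \<and> v $ 2 \<ge> 0 \<and> v $ 1 + v $ 2 \<le> real n}"

definition cell :: "bool \<times> nat \<times> nat \<Rightarrow> (real^2) set" where
  "cell = (\<lambda>(d, i, j). if d
     then {v. v $ 1 \<ge> real i \<and> v $ 2 \<ge> real j \<and> v $ 1 + v $ 2 \<le> real i + real j + 1}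
     else {v. v $ 1 \<le> real i + 1 \<and> v $ 2 \<le> real j + 1 \<and> v $ 1 + v $ 2 \<ge> real i + real j + 1})"

text \<open>The inverted cell of a unit square reaches coordinate sum \<open>i + j + 2\<close>, one
  more than the upright cell, hence the extra 1.\<close>

definition cell_index :: "nat \<Rightarrow> (bool \<times> nat \<times> nat) set" where
  "cell_index n = {(d, i, j). i + j + (if d then 0 else 1) < n}"

definition block :: "nat \<Rightarrow> nat \<Rightarrow> (bool \<times> nat \<times> nat) set" where
  "block q p = {(d, i, j). i < q \<and> j < p}"

definition rect :: "nat \<Rightarrow> nat \<Rightarrow> (real^2) set" where
  "rect q p = {v. 0 \<le> v $ 1 \<and> v $ 1 \<le> real q \<and> 0 \<le> v $ 2 \<and> v $ 2 \<le> real p}"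

section \<open>Counting the cells and covering the triangle and the block by them\<close>

lemma cell_bounds:
  assumes "v \<in> cell (d, i, j)"
  shows "real i \<le> v $ 1" "v $ 1 \<le> real i + 1" "real j \<le> v $ 2" "v $ 2 \<le> real j + 1"
  using assms by (auto simp: cell_def split: if_splits)

text \<open>Enlarging the triangle by one step adds a strip of \<open>n + 1\<close> upright and
  \<open>n\<close> inverted cells, which matches the difference of consecutive squares.\<close>

lemma cell_index_Suc:
  "cell_index (Suc n) = cell_index n \<union> (\<lambda>i. (True, i, n - i)) ` {..n} \<union> (\<lambda>i. (False, i, n - 1 - i)) ` {..<n}"
proof (intro set_eqI iffI)
  fix t assume t: "t \<in> cell_index (Suc n)"
  obtain d i j where dij: "t = (d, i, j)"
    by (cases t) auto
  consider "t \<in> cell_index n" | "d" "i + j = n" | "\<not> d" "i + j + 1 = n"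
    using t less_Suc_eq unfolding dij cell_index_def by (cases d) auto
  then show "t \<in> cell_index n \<union> (\<lambda>i. (True, i, n - i)) ` {..n} \<union> (\<lambda>i. (False, i, n - 1 - i)) ` {..<n}"
    unfolding dij by cases force+
qed (auto simp: cell_index_def)

lemma card_cell_index: "finite (cell_index n) \<and> card (cell_index n) = n\<^sup>2"
proof (induction n)
  case 0
  have "cell_index 0 = {}"
    by (auto simp: cell_index_def)
  then show ?case by simp
next
  case (Suc n)
  let ?U = "(\<lambda>i. (True, i, n - i)) ` {..n}" and ?D = "(\<lambda>i. (False, i, n - 1 - i)) ` {..<n}"
  have "card ?U = Suc n" "card ?D = n"
    by (subst card_image; simp add: inj_on_def)+
  moreover have "card (cell_index n \<union> ?U) = card (cell_index n) + card ?U"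
    using Suc by (intro card_Un_disjoint) (auto simp: cell_index_def)
  moreover have "card (cell_index n \<union> ?U \<union> ?D) = card (cell_index n \<union> ?U) + card ?D"
    using Suc by (intro card_Un_disjoint) (auto simp: cell_index_def)
  ultimately show ?case
    using Suc unfolding cell_index_Suc by (simp add: power2_eq_square)
qed

text \<open>The far corner of the block has coordinate sum \<open>q + p\<close>, so the lower bound
  on \<open>r\<close> is what keeps the block inside the triangle.\<close>

lemma block_subset_cell_index: "p + q \<le> n \<Longrightarrow> block q p \<subseteq> cell_index n"
  by (auto simp: block_def cell_index_def)

lemma cell_cover:
  assumes "real i \<le> v $ 1" "v $ 1 \<le> real i + 1" "real j \<le> v $ 2" "v $ 2 \<le> real j + 1"
  shows "v \<in> cell (v $ 1 + v $ 2 \<le> real i + real j + 1, i, j)"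
  using assms by (auto simp: cell_def)

lemma Union_cells:
  assumes "n > 0"
  shows "(\<Union>t\<in>cell_index n. cell t) = std_triangle n"
proof
  have "v \<in> std_triangle n" if "(d, i, j) \<in> cell_index n" and v: "v \<in> cell (d, i, j)" for v d i j
  proof -
    have "real i + real j + (if d then 0 else 1) + 1 \<le> real n"
      using that(1) by (auto simp: cell_index_def)
    then show ?thesis
      using v cell_bounds[OF v] by (auto simp: cell_def std_triangle_def split: if_splits)
  qed
  then show "(\<Union>t\<in>cell_index n. cell t) \<subseteq> std_triangle n"
    by auto
next
  show "std_triangle n \<subseteq> (\<Union>t\<in>cell_index n. cell t)"
  proof
    fix v assume v: "v \<in> std_triangle n"
    define i j where "i = nat \<lfloor>v $ 1\<rfloor>" and "j = nat \<lfloor>v $ 2\<rfloor>"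
    have ij: "real i \<le> v $ 1" "v $ 1 \<le> real i + 1" "real j \<le> v $ 2" "v $ 2 \<le> real j + 1"
      using v unfolding i_def j_def std_triangle_def by (simp; linarith)+
    have sum: "v $ 1 + v $ 2 \<le> real n"
      using v by (simp add: std_triangle_def)
    show "v \<in> (\<Union>t\<in>cell_index n. cell t)"
    proof (cases "i + j < n")
      case True
      \<comment> \<open>For a point beyond the antidiagonal of its square, \<open>i + j + 1\<close>
        is less than the coordinate sum, hence less than \<open>n\<close>; so the inverted cell has
        a valid index.\<close>
      define d where "d \<longleftrightarrow> v $ 1 + v $ 2 \<le> real i + real j + 1"
      have "(d, i, j) \<in> cell_index n"
        using True sum unfolding cell_index_def d_def by auto
      then show ?thesis
        using cell_cover[OF ij] unfolding d_def by blast
    next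
      \<comment> \<open>Only lattice points on the side opposite the origin remain. Their floor
        square is outside the triangle, but each is a corner of the upright cell just below or just
        to the left.\<close>
      case False
      then have "real n \<le> real i + real j"
        by simp
      then have eq: "v $ 1 = real i" "v $ 2 = real j" "real i + real j = real n"
        using ij sum by linarith+
      then have "i + j = n"
        by linarith
      show ?thesis
      proof (cases i)
        case 0
        then have "(True, i, j - 1) \<in> cell_index n" "v \<in> cell (True, i, j - 1)"
          using \<open>i + j = n\<close> \<open>n > 0\<close> eq by (auto simp: cell_index_def cell_def)
        then show ?thesis by blast
      next
        case (Suc k)
        then have "(True, k, j) \<in> cell_index n" "v \<in> cell (True, k, j)"
          using \<open>i + j = n\<close> eq by (auto simp: cell_index_def cell_def)
        then show ?thesis by blast
      qed
    qed
  qed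
qed

lemma Union_block:
  assumes "p > 0" "q > 0"
  shows "(\<Union>t\<in>block q p. cell t) = rect q p"
proof
  have "v \<in> rect q p" if "(d, i, j) \<in> block q p" and v: "v \<in> cell (d, i, j)" for v d i j
  proof -
    have "real i + 1 \<le> real q" "real j + 1 \<le> real p"
      using that(1) by (auto simp: block_def)
    then show ?thesis
      using cell_bounds[OF v] by (auto simp: rect_def)
  qed
  then show "(\<Union>t\<in>block q p. cell t) \<subseteq> rect q p"
    by auto
next
  have step: "\<exists>i<m. real i \<le> x \<and> x \<le> real i + 1" if "0 \<le> x" "x \<le> real m" "m > 0" for x m
  proof (cases "x = real m")
    \<comment> \<open>At the right end the floor would be \<open>m\<close>, which is out of range,
      so the last unit interval is taken.\<close>
    case True
    then show ?thesis
      using that by (intro exI[of _ "m - 1"]) auto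
  next
    case False
    then show ?thesis
      using that by (intro exI[of _ "nat \<lfloor>x\<rfloor>"]) linarith
  qed
  show "rect q p \<subseteq> (\<Union>t\<in>block q p. cell t)"
  proof
    fix v assume v: "v \<in> rect q p"
    obtain i where i: "i < q" "real i \<le> v $ 1" "v $ 1 \<le> real i + 1"
      using step[of "v $ 1" q] v assms by (auto simp: rect_def)
    obtain j where j: "j < p" "real j \<le> v $ 2" "v $ 2 \<le> real j + 1"
      using step[of "v $ 2" p] v assms by (auto simp: rect_def)
    show "v \<in> (\<Union>t\<in>block q p. cell t)"
      using cell_cover[OF i(2,3) j(2,3)] i(1) j(1) by (auto simp: block_def)
  qed
qed

section \<open>Separating cells by lines\<close>

lemma interiors_disjoint_halfspaces:
  fixes w :: "'a::euclidean_space"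
  assumes "w \<noteq> 0" "S \<subseteq> {x. w \<bullet> x \<le> c}" "S' \<subseteq> {x. w \<bullet> x \<ge> c}"
  shows "interior S \<inter> interior S' = {}"
proof -
  have "interior S \<subseteq> {x. w \<bullet> x < c}" "interior S' \<subseteq> {x. w \<bullet> x > c}"
    using interior_mono[OF assms(2)] interior_mono[OF assms(3)] assms(1) by auto
  then show ?thesis by fastforce
qed

lemma interiors_disjoint_coordinate:
  fixes S S' :: "(real^'n) set"
  assumes "\<And>v. v \<in> S \<Longrightarrow> v $ i \<le> c" "\<And>v. v \<in> S' \<Longrightarrow> v $ i \<ge> c"
  shows "interior S \<inter> interior S' = {}"
  using assms
  by (intro interiors_disjoint_halfspaces[of "axis i 1" _ c])
     (auto simp: inner_axis axis_eq_0_iff inner_commute)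

text \<open>Cells of different unit squares are separated by a line parallel to an axis, the two
  cells of one square by its antidiagonal.\<close>

lemma cells_interiors_disjoint:
  assumes "t \<noteq> t'"
  shows "interior (cell t) \<inter> interior (cell t') = {}"
proof -
  obtain d i j d' i' j' where t: "t = (d, i, j)" "t' = (d', i', j')"
    by (cases t, cases t') auto
  consider "i < i'" | "i' < i" | "j < j'" | "j' < j" | "i = i'" "j = j'" "d \<noteq> d'"
    using assms t by force
  then show ?thesis
  proof cases
    case 1
    then have "real i + 1 \<le> real i'" by simp
    then show ?thesis
      unfolding t using cell_bounds
      by (intro interiors_disjoint_coordinate[of _ 1 "real i'"]) (fastforce intro: order_trans)+
  next
    case 2
    then have "real i' + 1 \<le> real i" by simp
    then show ?thesis
      unfolding t using cell_bounds
      by (subst Int_commute, intro interiors_disjoint_coordinate[of _ 1 "real i"])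
         (fastforce intro: order_trans)+
  next
    case 3
    then have "real j + 1 \<le> real j'" by simp
    then show ?thesis
      unfolding t using cell_bounds
      by (intro interiors_disjoint_coordinate[of _ 2 "real j'"]) (fastforce intro: order_trans)+
  next
    case 4
    then have "real j' + 1 \<le> real j" by simp
    then show ?thesis
      unfolding t using cell_bounds
      by (subst Int_commute, intro interiors_disjoint_coordinate[of _ 2 "real j"])
         (fastforce intro: order_trans)+
  next
    case 5
    have "interior (cell (True, i, j)) \<inter> interior (cell (False, i, j)) = {}"
    \<comment> \<open>The constant \<open>1\<close> is the vector with both entries 1, so the inner
      product with it is the coordinate sum.\<close>
    proof (rule interiors_disjoint_halfspaces[where w = "1 :: real^2" and c = "real i + real j + 1"])
      show "(1 :: real^2) \<noteq> 0" by simp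
    qed (auto simp: cell_def inner_vec_def sum_2)
    then show ?thesis
      unfolding t using 5 by (cases d; cases d') auto
  qed
qed

section \<open>Reflecting the block\<close>

text \<open>This linear map exchanges the sides \<open>(q, 0)\<close> and \<open>(0, p)\<close> of
  the block. It becomes a Euclidean reflection in the plane of the triangle once these sides get
  equal length there; see \<open>norm_frame_flip\<close>.\<close>

definition flip :: "nat \<Rightarrow> nat \<Rightarrow> real^2 \<Rightarrow> real^2" where
  "flip q p v = vector [v $ 2 * (real q / real p), v $ 1 * (real p / real q)]"

definition piece :: "nat \<Rightarrow> nat \<Rightarrow> bool \<times> nat \<times> nat \<Rightarrow> (real^2) set" where
  "piece q p t = (if t \<in> block q p then flip q p ` cell t else cell t)"

lemma flip_nth [simp]:
  "flip q p v $ 1 = v $ 2 * (real q / real p)" "flip q p v $ 2 = v $ 1 * (real p / real q)"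
  by (simp_all add: flip_def)

lemma linear_flip: "linear (flip q p)"
  by (rule linearI) (simp_all add: vec_eq_iff forall_2 ring_distribs add_divide_distrib)

lemma flip_flip: "p > 0 \<Longrightarrow> q > 0 \<Longrightarrow> flip q p (flip q p v) = v"
  by (simp add: vec_eq_iff forall_2)

lemma inj_flip: "p > 0 \<Longrightarrow> q > 0 \<Longrightarrow> inj (flip q p)"
  by (metis flip_flip injI)

lemma flip_rect:
  assumes "p > 0" "q > 0"
  shows "flip q p ` rect q p = rect q p"
proof -
  have "flip q p ` rect q p \<subseteq> rect q p"
    using assms by (auto simp: rect_def field_simps)
  moreover from this have "rect q p \<subseteq> flip q p ` rect q p"
    using flip_flip[OF assms] by (metis (no_types, lifting) image_eqI image_subset_iff subsetI)
  ultimately show ?thesis by blast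
qed

text \<open>The block fills a rectangle that \<open>flip\<close> maps onto itself, so reflecting its
  cells leaves the total union unchanged.\<close>

lemma Union_pieces:
  assumes "p > 0" "q > 0" "p + q \<le> n"
  shows "(\<Union>t\<in>cell_index n. piece q p t) = std_triangle n"
proof -
  have split: "cell_index n = block q p \<union> (cell_index n - block q p)"
    using block_subset_cell_index[OF assms(3)] by blast
  have "(\<Union>t\<in>cell_index n. piece q p t)
      = (\<Union>t\<in>block q p. piece q p t) \<union> (\<Union>t\<in>cell_index n - block q p. piece q p t)"
    by (subst split) blast
  also have "(\<Union>t\<in>block q p. piece q p t) = flip q p ` (\<Union>t\<in>block q p. cell t)"
    by (auto simp: piece_def image_UN)
  also have "\<dots> = (\<Union>t\<in>block q p. cell t)"
    using assms by (simp add: Union_block flip_rect)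
  also have "(\<Union>t\<in>cell_index n - block q p. piece q p t) = (\<Union>t\<in>cell_index n - block q p. cell t)"
    by (simp add: piece_def)
  also have "(\<Union>t\<in>block q p. cell t) \<union> \<dots> = (\<Union>t\<in>cell_index n. cell t)"
    by (subst (2) split) blast
  finally show ?thesis
    using Union_cells[of n] assms by simp
qed

text \<open>A reflected cell stays in the rectangle, while a cell outside the block has
  \<open>q \<le> i\<close> or \<open>p \<le> j\<close> and so lies beyond one of the rectangle's two
  outer sides.\<close>

lemma flipped_piece_disjoint:
  assumes "p > 0" "q > 0" "t \<in> block q p" "t' \<notin> block q p"
  shows "interior (piece q p t) \<inter> interior (piece q p t') = {}"
proof -
  obtain d i j where t': "t' = (d, i, j)"
    by (cases t') auto
  have "cell t \<subseteq> rect q p"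
    using Union_block[OF assms(1,2)] assms(3) by blast
  then have "piece q p t \<subseteq> rect q p"
    using flip_rect[OF assms(1,2)] assms(3) by (auto simp: piece_def)
  then have le: "v $ 1 \<le> real q" "v $ 2 \<le> real p" if "v \<in> piece q p t" for v
    using that by (auto simp: rect_def)
  have piece': "piece q p t' = cell (d, i, j)"
    using assms(4) t' by (simp add: piece_def)
  have "q \<le> i \<or> p \<le> j"
    using assms(4) t' by (auto simp: block_def)
  then show ?thesis
  proof
    assume "q \<le> i"
    then have "real q \<le> real i" by simp
    then show ?thesis
      unfolding piece' using le cell_bounds(1)
      by (intro interiors_disjoint_coordinate[of _ 1 "real q"]) (fastforce intro: order_trans)+
  next
    assume "p \<le> j"
    then have "real p \<le> real j" by simp
    then show ?thesis
      unfolding piece' using le cell_bounds(3)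
      by (intro interiors_disjoint_coordinate[of _ 2 "real p"]) (fastforce intro: order_trans)+
  qed
qed

lemma pieces_interiors_disjoint:
  assumes "p > 0" "q > 0" "t \<noteq> t'"
  shows "interior (piece q p t) \<inter> interior (piece q p t') = {}"
proof (cases "t \<in> block q p \<longleftrightarrow> t' \<in> block q p")
  case True
  \<comment> \<open>If both cells are reflected, injectivity and linearity of \<open>flip\<close>
    carry over the disjointness of the original interiors.\<close>
  have "interior (flip q p ` cell t) \<inter> interior (flip q p ` cell t')
      = flip q p ` (interior (cell t) \<inter> interior (cell t'))"
    using interior_injective_linear_image[OF linear_flip inj_flip] assms
    by (simp add: image_Int[OF inj_flip])
  then show ?thesis
    using True cells_interiors_disjoint[OF assms(3)] by (auto simp: piece_def)
next
  case False
  then show ?thesis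
    using flipped_piece_disjoint[OF assms(1,2)] by (metis Int_commute)
qed

lemma cell_scaled_triangle:
  assumes "n > 0"
  obtains c k where "\<bar>k\<bar> = 1 / real n" "cell t = (\<lambda>v. c + k *\<^sub>R v) ` std_triangle n"
proof -
  obtain d i j where t: "t = (d, i, j)"
    by (cases t) auto
  \<comment> \<open>The origin goes to the corner \<open>(i, j)\<close> of an upright cell and to
    \<open>(i + 1, j + 1)\<close> of an inverted one. The latter is reached by a point reflection,
    hence the negative factor.\<close>
  define e :: real where "e = (if d then 0 else 1)"
  define k :: real where "k = (if d then 1 / real n else - 1 / real n)"
  define c :: "real^2" where "c = vector [real i + e, real j + e]"
  have "cell t = (\<lambda>v. c + k *\<^sub>R v) ` std_triangle n"
  proof
    show "(\<lambda>v. c + k *\<^sub>R v) ` std_triangle n \<subseteq> cell t"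
    proof (rule image_subsetI)
      fix v :: "real^2" assume "v \<in> std_triangle n"
      then have "0 \<le> v $ 1 / real n" "0 \<le> v $ 2 / real n" "v $ 1 / real n + v $ 2 / real n \<le> 1"
        using assms by (auto simp: std_triangle_def simp flip: add_divide_distrib)
      then show "c + k *\<^sub>R v \<in> cell t"
        unfolding t by (simp add: cell_def c_def e_def k_def)
    qed
    show "cell t \<subseteq> (\<lambda>v. c + k *\<^sub>R v) ` std_triangle n"
    proof
      fix v assume v: "v \<in> cell t"
      have "v = c + k *\<^sub>R ((1 / k) *\<^sub>R (v - c))"
        using assms by (simp add: k_def)
      moreover have "(1 / k) *\<^sub>R (v - c) \<in> std_triangle n"
      proof (cases d)
        case True
        then have "real n * ((v $ 1 - real i) + (v $ 2 - real j)) \<le> real n * 1"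
          using v unfolding t by (intro mult_left_mono) (auto simp: cell_def)
        moreover have "real n * real i \<le> real n * v $ 1" "real n * real j \<le> real n * v $ 2"
          using cell_bounds v unfolding t by (auto intro!: mult_left_mono)
        ultimately show ?thesis
          using True by (simp add: std_triangle_def c_def e_def k_def algebra_simps)
      next
        case False
        then have "real n * ((real i + 1 - v $ 1) + (real j + 1 - v $ 2)) \<le> real n * 1"
          using v unfolding t by (intro mult_left_mono) (auto simp: cell_def)
        moreover have "real n * v $ 1 \<le> real n * (real i + 1)" "real n * v $ 2 \<le> real n * (real j + 1)"
          using cell_bounds v unfolding t by (auto intro!: mult_left_mono)
        ultimately show ?thesis
          using False by (simp add: std_triangle_def c_def e_def k_def algebra_simps)
      qed
      ultimately show "v \<in> (\<lambda>v. c + k *\<^sub>R v) ` std_triangle n" by blast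
    qed
  qed
  moreover have "\<bar>k\<bar> = 1 / real n"
    by (simp add: k_def)
  ultimately show thesis
    using that by blast
qed

section \<open>Back to the given triangle\<close>

definition frame :: "real^2 \<Rightarrow> real^2 \<Rightarrow> real^2 \<Rightarrow> real^2" where
  "frame e1 e2 v = v $ 1 *\<^sub>R e1 + v $ 2 *\<^sub>R e2"

lemma linear_frame: "linear (frame e1 e2)"
  by (rule linearI) (simp_all add: frame_def algebra_simps)

lemma inj_frame:
  assumes "\<not> collinear {0, e1, e2}"
  shows "inj (frame e1 e2)"
proof -
  have "v = 0" if v: "v $ 1 *\<^sub>R e1 + v $ 2 *\<^sub>R e2 = 0" for v :: "real^2"
  proof -
    have nz: "e1 \<noteq> 0" "e2 \<noteq> 0" "\<And>c. e2 \<noteq> c *\<^sub>R e1"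
      using assms unfolding collinear_lemma by auto
    have "v $ 2 = 0"
    proof (rule ccontr)
      assume v2: "v $ 2 \<noteq> 0"
      have "e2 = (1 / v $ 2) *\<^sub>R (v $ 2 *\<^sub>R e2)"
        using v2 by simp
      also have "v $ 2 *\<^sub>R e2 = - (v $ 1 *\<^sub>R e1)"
        using v by (simp add: eq_neg_iff_add_eq_0 add.commute)
      finally have "e2 = (- (v $ 1 / v $ 2)) *\<^sub>R e1"
        by simp
      then show False
        using nz(3) by blast
    qed
    moreover from this have "v $ 1 = 0"
      using v nz(1) by simp
    ultimately show ?thesis
      by (simp add: vec_eq_iff forall_2)
  qed
  then show ?thesis
    unfolding linear_injective_0[OF linear_frame] frame_def by blast
qed

text \<open>The squared norm of \<open>x *\<^sub>R e1 + y *\<^sub>R e2\<close> is a quadratic form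
  in \<open>x\<close> and \<open>y\<close>. By the assumed equality of lengths, \<open>flip\<close>
  exchanges its two square terms, and it preserves the product of the coordinates in the mixed
  term.\<close>

lemma norm_frame_flip:
  assumes "p > 0" "q > 0" "real q * norm e1 = real p * norm e2"
  shows "norm (frame e1 e2 (flip q p v)) = norm (frame e1 e2 v)"
proof -
  have sq: "(norm (x *\<^sub>R e1 + y *\<^sub>R e2))\<^sup>2
      = (x * norm e1)\<^sup>2 + 2 * (x * y) * (e1 \<bullet> e2) + (y * norm e2)\<^sup>2" for x y
    unfolding power2_norm_eq_inner power_mult_distrib
    by (simp add: inner_add_left inner_add_right inner_commute power2_eq_square algebra_simps)
  have "real q / real p * norm e1 = norm e2" "real p / real q * norm e2 = norm e1"
    using assms by (simp_all add: field_simps)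
  then have "v $ 2 * (real q / real p) * norm e1 = v $ 2 * norm e2"
    "v $ 1 * (real p / real q) * norm e2 = v $ 1 * norm e1"
    by (metis mult.assoc)+
  moreover have "v $ 2 * (real q / real p) * (v $ 1 * (real p / real q)) = v $ 1 * v $ 2"
    using assms by simp
  ultimately have "(norm (frame e1 e2 (flip q p v)))\<^sup>2 = (norm (frame e1 e2 v))\<^sup>2"
    unfolding frame_def flip_nth sq by simp
  then show ?thesis
    by (simp add: power2_eq_iff_nonneg)
qed

text \<open>Conjugating by \<open>frame\<close> turns a coordinate map into a map of the plane. The
  scaling condition is therefore put on norms after \<open>frame\<close>, not on norms of coordinate
  vectors.\<close>

lemma scaled_copy_frame:
  assumes inj: "inj (frame e1 e2)" and M: "linear M"
    and norm_M: "\<And>v. norm (frame e1 e2 (M v)) = k * norm (frame e1 e2 v)"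
  shows "scaled_copy k ((\<lambda>v. C + frame e1 e2 v) ` P) ((\<lambda>v. C + frame e1 e2 (c + M v)) ` P)"
proof -
  let ?f = "frame e1 e2"
  obtain g where g: "linear g" "\<And>v. g (?f v) = v" "\<And>v. ?f (g v) = v"
    using linear_injective_isomorphism[OF linear_frame inj] by blast
  define L where "L = ?f \<circ> M \<circ> g"
  have "linear L"
    unfolding L_def by (intro linear_compose g(1) M linear_frame)
  moreover have "norm (L v) = k * norm v" for v
    by (simp add: L_def norm_M g(3))
  \<comment> \<open>The linear map \<open>L\<close> also moves the base point \<open>C\<close>, so
    the translation part subtracts \<open>L C\<close>.\<close>
  moreover have "(\<lambda>v. C + ?f (c + M v)) ` P
      = (\<lambda>w. (C + ?f c - L C) + L w) ` (\<lambda>v. C + ?f v) ` P"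
    by (simp add: image_image linear_add[OF \<open>linear L\<close>] linear_add[OF linear_frame] algebra_simps)
       (simp add: L_def g(2))
  ultimately show ?thesis
    unfolding scaled_copy_def by blast
qed

lemma scaled_copy_piece:
  assumes "p > 0" "q > 0" "n > 0" and inj: "inj (frame e1 e2)"
    and eq: "real q * norm e1 = real p * norm e2"
  shows "scaled_copy (1 / real n) ((\<lambda>v. C + frame e1 e2 v) ` std_triangle n)
    ((\<lambda>v. C + frame e1 e2 v) ` piece q p t)"
proof -
  obtain c k where k: "\<bar>k\<bar> = 1 / real n" and cell: "cell t = (\<lambda>v. c + k *\<^sub>R v) ` std_triangle n"
    using cell_scaled_triangle[OF assms(3)] by blast
  have norm_k: "norm (frame e1 e2 (k *\<^sub>R v)) = 1 / real n * norm (frame e1 e2 v)" for v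
    by (simp add: linear_cmul[OF linear_frame] k)
  show ?thesis
  proof (cases "t \<in> block q p")
    case True
    \<comment> \<open>By linearity the reflected cell is the set of all
      \<open>flip q p c + k *\<^sub>R flip q p v\<close>; the sign of \<open>k\<close> disappears in
      the norm.\<close>
    have "linear (\<lambda>v. k *\<^sub>R flip q p v)"
      by (intro linear_compose_scale_right linear_flip)
    moreover have "norm (frame e1 e2 (k *\<^sub>R flip q p v)) = 1 / real n * norm (frame e1 e2 v)" for v
      unfolding norm_k norm_frame_flip[OF assms(1,2) eq] ..
    ultimately show ?thesis
      using scaled_copy_frame[OF inj, of "\<lambda>v. k *\<^sub>R flip q p v" "1 / real n" C "std_triangle n"
          "flip q p c"] True
      by (simp add: piece_def cell image_image linear_add[OF linear_flip]
          linear_cmul[OF linear_flip])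
  next
    case False
    have "linear ((*\<^sub>R) k :: real^2 \<Rightarrow> real^2)"
      by simp
    then show ?thesis
      using scaled_copy_frame[OF inj _ norm_k, of C "std_triangle n" c] False
      by (simp add: piece_def cell image_image)
  qed
qed

lemma interior_frame_image:
  assumes "inj (frame e1 e2)"
  shows "interior ((\<lambda>v. C + frame e1 e2 v) ` P) = (\<lambda>v. C + frame e1 e2 v) ` interior P"
proof -
  have eq: "(\<lambda>v. C + frame e1 e2 v) ` Q = (+) C ` frame e1 e2 ` Q" for Q
    by (simp add: image_image)
  show ?thesis
    unfolding eq interior_translation interior_injective_linear_image[OF linear_frame assms] ..
qed

lemma std_triangle_image:
  assumes "n > 0"
  shows "(\<lambda>v. C + frame ((1 / real n) *\<^sub>R (A - C)) ((1 / real n) *\<^sub>R (B - C)) v) ` std_triangle n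
    = convex hull {A, B, C}"
proof -
  have "convex hull {A, B, C} = convex hull {C, A, B}"
    by (simp add: insert_commute)
  also have "\<dots> = {C + x *\<^sub>R (A - C) + y *\<^sub>R (B - C) | x y. 0 \<le> x \<and> 0 \<le> y \<and> x + y \<le> 1}"
    by (rule convex_hull_3_alt)
  also have "\<dots> = (\<lambda>v. C + frame ((1 / real n) *\<^sub>R (A - C)) ((1 / real n) *\<^sub>R (B - C)) v) ` std_triangle n"
    (is "?L = ?R")
  proof
    show "?R \<subseteq> ?L"
    proof safe
      fix v assume v: "v \<in> std_triangle n"
      then have "0 \<le> v $ 1 / real n" "0 \<le> v $ 2 / real n" "v $ 1 / real n + v $ 2 / real n \<le> 1"
        using assms by (auto simp: std_triangle_def simp flip: add_divide_distrib)
      then show "\<exists>x y. C + frame ((1 / real n) *\<^sub>R (A - C)) ((1 / real n) *\<^sub>R (B - C)) v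
          = C + x *\<^sub>R (A - C) + y *\<^sub>R (B - C) \<and> 0 \<le> x \<and> 0 \<le> y \<and> x + y \<le> 1"
        by (intro exI[of _ "v $ 1 / real n"] exI[of _ "v $ 2 / real n"]) (simp add: frame_def)
    qed
    show "?L \<subseteq> ?R"
    proof safe
      fix x y :: real assume xy: "0 \<le> x" "0 \<le> y" "x + y \<le> 1"
      define v :: "real^2" where "v = vector [real n * x, real n * y]"
      have "real n * (x + y) \<le> real n * 1"
        using xy by (intro mult_left_mono) auto
      then have "v \<in> std_triangle n"
        using xy by (simp add: v_def std_triangle_def algebra_simps)
      moreover have "C + x *\<^sub>R (A - C) + y *\<^sub>R (B - C)
          = C + frame ((1 / real n) *\<^sub>R (A - C)) ((1 / real n) *\<^sub>R (B - C)) v"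
        using assms by (simp add: v_def frame_def)
      ultimately show "C + x *\<^sub>R (A - C) + y *\<^sub>R (B - C) \<in> ?R" by blast
    qed
  qed
  finally show ?thesis by simp
qed

lemma reptiling_pieces:
  assumes ncol: "\<not> collinear {A, B, C}"
    and "p > 0" "q > 0" "p + q \<le> n"
    and eq: "real q * dist C A = real p * dist B C"
    and e: "e1 = (1 / real n) *\<^sub>R (A - C)" "e2 = (1 / real n) *\<^sub>R (B - C)"
  shows "reptiling (n\<^sup>2) (convex hull {A, B, C})
    ((\<lambda>t. (\<lambda>v. C + frame e1 e2 v) ` piece q p t) ` cell_index n)"
    and "inj (frame e1 e2)"
proof -
  let ?F = "\<lambda>v. C + frame e1 e2 v" and ?T = "convex hull {A, B, C}"
  define tile where "tile t = ?F ` piece q p t" for t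
  have n: "n \<ge> 2"
    using assms by linarith
  then have scale: "1 / real n > 0"
    by simp
  have T: "?T = ?F ` std_triangle n"
    using std_triangle_image[of n C A B] n e by simp
  have triangle: "is_triangle ?T"
    unfolding is_triangle_def using ncol by blast
  have "\<not> collinear {0, A - C, B - C}"
    using ncol collinear_3[of A C B] by (simp add: insert_commute)
  then have "\<not> collinear {0, e1, e2}"
    unfolding e collinear_scaleR_iff using n by simp
  then show inj: "inj (frame e1 e2)"
    using inj_frame by blast
  have norms: "real q * norm e1 = real p * norm e2"
    using eq by (simp add: e dist_norm norm_minus_commute)
  have copy: "scaled_copy (1 / real n) ?T (tile t)" for t
    unfolding T tile_def using scaled_copy_piece[OF assms(2,3) _ inj norms] n by simp
  have inj_F: "inj ?F"
    using inj by (auto simp: inj_def)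
  have disj: "interior (tile t) \<inter> interior (tile t') = {}" if "t \<noteq> t'" for t t'
    unfolding tile_def interior_frame_image[OF inj] image_Int[OF inj_F, symmetric]
      pieces_interiors_disjoint[OF assms(2,3) that] by simp
  \<comment> \<open>Needed for the cardinality: if two indices gave the same tile, its interior
    would be disjoint from itself, hence empty, which is impossible for a triangle.\<close>
  have inj_tile: "inj tile"
  proof (rule injI, rule ccontr)
    fix t t' assume "tile t = tile t'" "t \<noteq> t'"
    then have "interior (tile t) = {}"
      using disj[of t t'] by simp
    then show False
      using triangle_interior_nonempty scaled_copy_triangle[OF copy scale triangle] by blast
  qed
  have "(\<Union>t\<in>cell_index n. tile t) = ?T"
    unfolding tile_def image_UN[symmetric] Union_pieces[OF assms(2-4)] T ..
  moreover have "card (tile ` cell_index n) = n\<^sup>2"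
    using card_image[OF inj_on_subset[OF inj_tile]] card_cell_index by (metis subset_UNIV)
  moreover have "finite (tile ` cell_index n)"
    using card_cell_index by blast
  moreover have "n\<^sup>2 \<ge> 2"
    using order_trans[OF n self_le_power[of n 2]] n by linarith
  moreover have "pairwise (\<lambda>S S'. interior S \<inter> interior S' = {}) (tile ` cell_index n)"
    using disj by (intro pairwise_imageI)
  ultimately have "reptiling (n\<^sup>2) ?T (tile ` cell_index n)"
    unfolding reptiling_def
    using triangle scaled_copy_triangle[OF copy scale triangle] scaled_copy_similar[OF copy scale]
      scaled_copies_congruent[OF copy copy scale]
    by simp
  then show "reptiling (n\<^sup>2) ?T ((\<lambda>t. ?F ` piece q p t) ` cell_index n)"
    unfolding tile_def .
qed

section \<open>Tiles of the trivial reptiling and the grid lines\<close>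

lemma closure_connected_one_side:
  fixes h :: "'a::topological_space \<Rightarrow> real"
  assumes "connected K" "continuous_on UNIV h" "\<And>x. x \<in> K \<Longrightarrow> h x \<noteq> c"
  shows "closure K \<subseteq> {x. h x \<le> c} \<or> closure K \<subseteq> {x. h x \<ge> c}"
proof -
  have "K \<subseteq> {x. h x \<le> c} \<or> K \<subseteq> {x. h x \<ge> c}"
  proof (rule ccontr)
    assume "\<not> ?thesis"
    then obtain x y where "x \<in> K" "h x > c" "y \<in> K" "h y < c"
      by force
    moreover have "connected (h ` K)"
      using assms(1,2) connected_continuous_image continuous_on_subset by blast
    \<comment> \<open>Intermediate value argument: a connected set of reals with points on both
      sides of \<open>c\<close> contains \<open>c\<close>.\<close>
    ultimately have "c \<in> h ` K"
      by (meson connectedD_interval imageI less_imp_le)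
    then show False
      using assms(3) by blast
  qed
  moreover have "closed {x. h x \<le> c}" "closed {x. h x \<ge> c}"
    using assms(2) by (intro closed_Collect_le continuous_on_const; assumption)+
  ultimately show ?thesis
    using closure_minimal by blast
qed

text \<open>A component avoids every grid line and is connected, so neither it nor its closure
  crosses one. This obstruction suffices for non-triviality, without determining the components
  explicitly.\<close>

lemma trivial_tile_one_side:
  fixes h :: "real^2 \<Rightarrow> real"
  assumes "S \<in> trivial_reptiling n T" "l \<in> grid_lines n T"
    and "continuous_on UNIV h" "\<And>x. h x = c \<Longrightarrow> x \<in> l"
  shows "S \<subseteq> {x. h x \<le> c} \<or> S \<subseteq> {x. h x \<ge> c}"
proof -
  obtain K where K: "K \<in> components (T - \<Union>(grid_lines n T))" "S = closure K"
    using assms(1) unfolding trivial_reptiling_def by blast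
  have "h x \<noteq> c" if "x \<in> K" for x
    using in_components_subset[OF K(1)] assms(2,4) that by blast
  then show ?thesis
    unfolding K(2) by (rule closure_connected_one_side[OF in_components_connected[OF K(1)] assms(3)])
qed

theorem theorem4:
  fixes A B C :: "real^2" and T :: "(real^2) set" and a b :: real and p q r :: nat
  assumes "\<not> collinear {A, B, C}"
    and "T = convex hull {A, B, C}"
    and "a = dist B C"
    and "b = dist C A"
    and "p > 0" and "q > 0" and "p \<noteq> q"
    and "b / a = real p / real q"
    and "\<exists>n. r = n\<^sup>2"
    and "r \<ge> (p + q)\<^sup>2"
  shows "\<exists>R. nontrivial_reptiling r T R"
proof -
  obtain n where r: "r = n\<^sup>2"
    using assms(9) by blast
  have n: "p + q \<le> n"
    using assms(10) unfolding r by (simp add: power2_nat_le_eq_le)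
  then have "n > 0"
    using assms(5) by simp
  define e1 e2 where e: "e1 = (1 / real n) *\<^sub>R (A - C)" "e2 = (1 / real n) *\<^sub>R (B - C)"
  let ?F = "\<lambda>v. C + frame e1 e2 v"
  define R where "R = (\<lambda>t. ?F ` piece q p t) ` cell_index n"
  have distinct: "A \<noteq> B" "B \<noteq> C" "A \<noteq> C" and indep: "\<not> affine_dependent {A, B, C}"
    using assms(1) unfolding collinear_3_eq_affine_dependent by auto
  have "real q * dist C A = real p * dist B C"
    using assms(3,4,6,8) distinct by (simp add: field_simps)
  note tiling = reptiling_pieces[OF assms(1,5,6) n this e]
  have reptiling: "reptiling r T R"
    using tiling(1) unfolding R_def r assms(2) .
  have vertices: "A \<in> vertices T" "B \<in> vertices T" "C \<in> vertices T"
    using indep unfolding vertices_def assms(2)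
    by (simp_all add: extreme_point_of_convex_hull_affine_independent)
  have division: "C + e1 \<in> division_points n T" "C + e2 \<in> division_points n T"
    using vertices \<open>n > 0\<close> unfolding division_points_def e
    by (force intro!: exI[of _ "1::nat"])+
  obtain g where g: "linear g" "\<And>v. g (frame e1 e2 v) = v" "\<And>v. frame e1 e2 (g v) = v"
    using linear_injective_isomorphism[OF linear_frame tiling(2)] by blast
  \<comment> \<open>\<open>h 1\<close> and \<open>h 2\<close> extend the affine coordinates to the
    whole plane. Their level sets at 1 are the grid lines nearest to \<open>C\<close> that are
    parallel to \<open>B - C\<close> and to \<open>A - C\<close>.\<close>
  define h where "h i x = g (x - C) $ i" for i x
  have h_F: "h i (?F v) = v $ i" for i v
    by (simp add: h_def g(2))
  have F_h: "x = C + h 1 x *\<^sub>R e1 + h 2 x *\<^sub>R e2" for x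
    using g(3)[of "x - C"] unfolding h_def frame_def by (simp add: algebra_simps)
  have cont: "continuous_on UNIV (h i)" for i
    unfolding h_def
    by (intro continuous_intros linear_continuous_on_compose[OF _ g(1)])
  \<comment> \<open>The reflected corner tile has vertices \<open>C\<close>,
    \<open>C + (q / p) *\<^sub>R e1\<close> and \<open>C + (p / q) *\<^sub>R e2\<close>; as
    \<open>p \<noteq> q\<close>, one of the two ratios exceeds 1.\<close>
  let ?S = "?F ` piece q p (True, 0, 0)"
  have "?S \<in> R"
    unfolding R_def using \<open>n > 0\<close> by (auto simp: cell_index_def)
  have piece0: "piece q p (True, 0, 0) = flip q p ` cell (True, 0, 0)"
    using assms(5,6) by (simp add: piece_def block_def)
  have corners: "(0::real^2) \<in> cell (True, 0, 0)" "axis 1 1 \<in> cell (True, 0, 0)"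
    "axis 2 1 \<in> cell (True, 0, 0)"
    by (auto simp: cell_def axis_def)
  then have in_S: "?F 0 \<in> ?S" "?F (flip q p (axis 1 1)) \<in> ?S" "?F (flip q p (axis 2 1)) \<in> ?S"
    unfolding piece0 by (metis (no_types, lifting) imageI linear_0[OF linear_flip])+
  have lines: "range (\<lambda>t. (C + e1) + t *\<^sub>R (B - C)) \<in> grid_lines n T"
    "range (\<lambda>t. (C + e2) + t *\<^sub>R (A - C)) \<in> grid_lines n T"
    using division vertices distinct unfolding grid_lines_def by blast+
  have "R \<noteq> trivial_reptiling n T"
  proof
    assume "R = trivial_reptiling n T"
    then have S: "?S \<in> trivial_reptiling n T"
      using \<open>?S \<in> R\<close> by simp
    \<comment> \<open>The line is parametrised by the full side \<open>B - C\<close>, which is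
      \<open>n\<close> times \<open>e2\<close>; this explains the division by
      \<open>n\<close>.\<close>
    have on_line1: "x \<in> range (\<lambda>t. (C + e1) + t *\<^sub>R (B - C))" if "h 1 x = 1" for x
      using F_h[of x] that by (intro range_eqI[of _ _ "h 2 x / real n"]) (simp add: e)
    have on_line2: "x \<in> range (\<lambda>t. (C + e2) + t *\<^sub>R (A - C))" if "h 2 x = 1" for x
      using F_h[of x] that by (intro range_eqI[of _ _ "h 1 x / real n"]) (simp add: e algebra_simps)
    have "?S \<subseteq> {x. h 1 x \<le> 1} \<or> ?S \<subseteq> {x. h 1 x \<ge> 1}"
      "?S \<subseteq> {x. h 2 x \<le> 1} \<or> ?S \<subseteq> {x. h 2 x \<ge> 1}"
      using trivial_tile_one_side[OF S lines(1) cont on_line1]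
        trivial_tile_one_side[OF S lines(2) cont on_line2] by blast+
    moreover have "h 1 (?F 0) = 0" "h 2 (?F 0) = 0"
      "h 1 (?F (flip q p (axis 2 1))) = real q / real p"
      "h 2 (?F (flip q p (axis 1 1))) = real p / real q"
      unfolding h_F by (simp_all add: axis_def)
    \<comment> \<open>Both coordinates vanish at the vertex \<open>C\<close>, which excludes the
      alternatives with \<open>\<ge> 1\<close>. So neither ratio exceeds 1, which forces
      \<open>p = q\<close>.\<close>
    ultimately have "real q / real p \<le> 1" "real p / real q \<le> 1"
      using in_S by force+
    then show False
      using assms(5-7) by simp
  qed
  then show ?thesis
    unfolding nontrivial_reptiling_def using reptiling r by blast
qed

end
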